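(* Let $A\in\mathbb{C}^{m\times n}$ and $B\in\mathbb{C}^{p\times n}$ with $\operatorname{rank}(B)=n$, and let $k\ge 1$ be an integer. Let $S_U\in\mathbb{C}^{m\times 3k}$ and $S_W\in\mathbb{C}^{n\times 3k}$ satisfy $S_U^{\mathsf H}S_U=I_{3k}$ and $S_W^{\mathsf H}B^{\mathsf H}BS_W=I_{3k}$. Put $$\check A=\begin{bmatrix} 0 & A \\ A^{\mathsf H} & 0 \end{bmatrix}\in\mathbb{C}^{(m+n)\times(m+n)},\qquad S=\frac{1}{\sqrt2}\begin{bmatrix} S_U & S_U \\ S_W & -S_W \end{bmatrix}\in\mathbb{C}^{(m+n)\times 6k}.$$ Suppose that $M=S_U^{\mathsf H}AS_W\in\mathbb{C}^{3k\times 3k}$ is nonsingular. Let $$V_+=\begin{bmatrix} V_+^{\mathrm{top}} \\ V_+^{\mathrm{bot}} \end{bmatrix}\in\mathbb{C}^{6k\times 3k},\qquad V_+^{\mathrm{top}},V_+^{\mathrm{bot}}\in\mathbb{C}^{3k\times 3k},$$ have orthonormal columns ($V_+^{\mathsf H}V_+=I_{3k}$) and satisfy $S^{\mathsf H}\check A S V_+=V_+\Theta$, where $\Theta\in\mathbb{R}^{3k\times 3k}$ is diagonal with positive diagonal entries. Then the matrices $$U^{\mathrm p}=V_+^{\mathrm{top}}+V_+^{\mathrm{bot}},\qquad W^{\mathrm p}=V_+^{\mathrm{top}}-V_+^{\mathrm{bot}}$$ are unitary and satisfy $$M=U^{\mathrm p}\,\Theta\,(W^{\mathrm p})^{\mathsf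 H}.$$ Furthermore, define $V_-=\begin{bmatrix} V_+^{\mathrm{bot}} \\ V_+^{\mathrm{top}} \end{bmatrix}\in\mathbb{C}^{6k\times 3k}$. Then $$S^{\mathsf H}\check A S V_-=-V_-\Theta,\qquad V_-^{\mathsf H}V_-=I_{3k},\qquad V_+^{\mathsf H}V_-=0.$$ Consequently, with $X_+=SV_+$ and $X_-=SV_-$, $$[X_+,X_-]=[SV_+,SV_-]=\frac1{\sqrt2}\begin{bmatrix} S_UU^{\mathrm p} & S_UU^{\mathrm p} \\ S_WW^{\mathrm p} & -S_WW^{\mathrm p} \end{bmatrix}.$$
   Context: $M^{\mathsf H}$ denotes the conjugate transpose of a matrix $M$, and $I_d$ is the identity matrix of order $d$. The superscript $\mathrm p$ in $U^{\mathrm p},W^{\mathrm p}$ is only a label (for "projected"), not a power. *)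

theory Defs
  imports Complex_Main "Jordan_Normal_Form.Schur_Decomposition" "Jordan_Normal_Form.DL_Rank"
begin

definition unitary_mat :: "complex mat \<Rightarrow> bool" where
  "unitary_mat U \<longleftrightarrow> square_mat U
     \<and> mat_adjoint U * U = 1\<^sub>m (dim_row U) \<and> U * mat_adjoint U = 1\<^sub>m (dim_row U)"

(* Column counterpart of append_rows; meaningful when both matrices have the same number of rows. *)
definition append_cols :: "'a :: zero mat \<Rightarrow> 'a mat \<Rightarrow> 'a mat" (infixr \<open>@\<^sub>c\<close> 65) where
  "A @\<^sub>c B = four_block_mat A B (0\<^sub>m 0 (dim_col A)) (0\<^sub>m 0 (dim_col B))"

end

theory Submission
  imports Defs
begin

text \<open>
  Write \<open>t\<close> and \<open>b\<close> for the two blocks of \<open>V_plus\<close>, and \<open>U = t + b\<close>, \<open>W = t - b\<close>. The basis \<open>S\<close>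
  is built so that it turns a stacked pair \<open>t, b\<close> into \<open>S\<^sub>U U\<close> on top of \<open>S\<^sub>W W\<close>, up to the factor
  \<open>1 / sqrt 2\<close> (\<open>sum_difference_basis_mult\<close>). Consequently \<open>S\<^sup>H A' S\<close> sends \<open>t, b\<close> to half the sum
  and half the difference of \<open>M W\<close> and \<open>M\<^sup>H U\<close> (\<open>compressed_dilation_mult\<close>), and the eigenvalue
  equation for \<open>V_plus\<close> is equivalent to the pair \<open>M W = U \<Theta>\<close>, \<open>M\<^sup>H U = W \<Theta>\<close>.

  Unitarity does not follow from orthonormality of \<open>V_plus\<close> alone, which says only that the Gram
  matrices \<open>G = U\<^sup>H U\<close> and \<open>H = W\<^sup>H W\<close> add up to twice the identity. But the pair of equations
  gives \<open>G \<Theta> = U\<^sup>H M W = \<Theta> H\<close>. Then \<open>D = H - 1 = 1 - G\<close> satisfies \<open>\<Theta> D + D \<Theta> = 0\<close>, that is,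
  \<open>(\<theta>\<^sub>i + \<theta>\<^sub>j) D\<^sub>i\<^sub>j = 0\<close>, and positivity of the \<open>\<theta>\<^sub>i\<close> forces \<open>D = 0\<close>
  (\<open>intertwined_complementary_eq_one\<close>, \<open>singular_pair_unitary\<close>). Multiplying \<open>M W = U \<Theta>\<close> by
  \<open>W\<^sup>H\<close> yields the factorization of \<open>M\<close>.

  Exchanging the blocks replaces \<open>(U, W)\<close> by \<open>(U, -W)\<close>, which explains the statements on
  \<open>V_minus\<close>; the cross Gram matrix of \<open>V_plus\<close> and \<open>V_minus\<close> is \<open>t\<^sup>H b + b\<^sup>H t = (G - H) / 2 = 0\<close>.
\<close>

section \<open>Conjugate transposes\<close>

lemma mat_adjoint_carrier [simp]:
  "A \<in> carrier_mat r c \<Longrightarrow> mat_adjoint A \<in> carrier_mat c r"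
  unfolding mat_adjoint_def by auto

lemma dim_mat_adjoint [simp]:
  "dim_row (mat_adjoint A) = dim_col A" "dim_col (mat_adjoint A) = dim_row A"
  unfolding mat_adjoint_def by auto

lemma index_mat_adjoint [simp]:
  "i < dim_col A \<Longrightarrow> j < dim_row A \<Longrightarrow> mat_adjoint A $$ (i, j) = conjugate (A $$ (j, i))"
  unfolding mat_adjoint_def by (simp add: mat_of_rows_index)

lemma mat_adjoint_adjoint [simp]: "mat_adjoint (mat_adjoint A) = A"
  by (rule eq_matI) auto

lemma mat_adjoint_add:
  "A \<in> carrier_mat r c \<Longrightarrow> B \<in> carrier_mat r c
    \<Longrightarrow> mat_adjoint (A + B) = mat_adjoint A + mat_adjoint B"
  by (rule eq_matI) (auto simp: conjugate_dist_add)

lemma mat_adjoint_minus: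
  fixes A B :: "complex mat"
  shows "A \<in> carrier_mat r c \<Longrightarrow> B \<in> carrier_mat r c
    \<Longrightarrow> mat_adjoint (A - B) = mat_adjoint A - mat_adjoint B"
  by (rule eq_matI) auto

lemma mat_adjoint_uminus:
  fixes A :: "complex mat"
  shows "mat_adjoint (- A) = - mat_adjoint A"
  by (rule eq_matI) auto

lemma mat_adjoint_smult:
  "mat_adjoint (a \<cdot>\<^sub>m A) = conjugate a \<cdot>\<^sub>m mat_adjoint A"
  by (rule eq_matI) (auto simp: conjugate_dist_mul)

lemma mat_adjoint_mult:
  fixes A B :: "complex mat"
  assumes "A \<in> carrier_mat r n" "B \<in> carrier_mat n c"
  shows "mat_adjoint (A * B) = mat_adjoint B * mat_adjoint A"
  using assms
  by (intro eq_matI) (auto simp: scalar_prod_def mult.commute intro!: sum.cong)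

lemma mat_adjoint_four_block:
  assumes "A \<in> carrier_mat r1 c1" "B \<in> carrier_mat r1 c2"
    "C \<in> carrier_mat r2 c1" "D \<in> carrier_mat r2 c2"
  shows "mat_adjoint (four_block_mat A B C D)
    = four_block_mat (mat_adjoint A) (mat_adjoint C) (mat_adjoint B) (mat_adjoint D)"
  using assms by (intro eq_matI) auto

lemma mat_adjoint_real_diagonal:
  assumes "T \<in> carrier_mat d d" "diagonal_mat T"
  shows "mat_adjoint (map_mat complex_of_real T) = map_mat complex_of_real T"
proof (rule eq_matI)
  fix i j assume "i < dim_row (map_mat complex_of_real T)" "j < dim_col (map_mat complex_of_real T)"
  then show "mat_adjoint (map_mat complex_of_real T) $$ (i, j) = map_mat complex_of_real T $$ (i, j)"
    using assms unfolding diagonal_mat_def by (cases "i = j") auto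
qed (use assms in auto)

section \<open>Vertically stacked matrices\<close>

lemma four_block_mult_append_rows:
  fixes X Y :: "'a :: semiring_0 mat"
  assumes "P \<in> carrier_mat r1 n1" "Q \<in> carrier_mat r1 n2"
    "R \<in> carrier_mat r2 n1" "S \<in> carrier_mat r2 n2"
    and "X \<in> carrier_mat n1 c" "Y \<in> carrier_mat n2 c"
  shows "four_block_mat P Q R S * (X @\<^sub>r Y) = (P * X + Q * Y) @\<^sub>r (R * X + S * Y)"
  unfolding append_rows_def
  by (subst mult_four_block_mat[OF assms(1-5) _ assms(6), of _ 0])
     (use assms in \<open>auto intro!: cong_four_block_mat eq_matI\<close>)

lemma append_rows_mult:
  fixes T :: "'a :: semiring_0 mat"
  assumes "X \<in> carrier_mat r1 n" "Y \<in> carrier_mat r2 n" "T \<in> carrier_mat n c"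
  shows "(X @\<^sub>r Y) * T = (X * T) @\<^sub>r (Y * T)"
proof -
  have "T = four_block_mat T (0\<^sub>m n 0) (0\<^sub>m 0 c) (0\<^sub>m 0 0)"
    using assms by (intro eq_matI) auto
  then have "(X @\<^sub>r Y) * T = (X @\<^sub>r Y) * four_block_mat T (0\<^sub>m n 0) (0\<^sub>m 0 c) (0\<^sub>m 0 0)"
    by simp
  also have "\<dots> = (X * T) @\<^sub>r (Y * T)"
    unfolding append_rows_def
    by (subst mult_four_block_mat[of _ r1 n _ 0 _ r2 _ _ c _ 0])
       (use assms in \<open>auto intro!: cong_four_block_mat eq_matI\<close>)
  finally show ?thesis .
qed

lemma adjoint_append_rows_mult:
  fixes X Y Z W :: "complex mat"
  assumes "X \<in> carrier_mat r1 c" "Y \<in> carrier_mat r2 c"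
    "Z \<in> carrier_mat r1 c'" "W \<in> carrier_mat r2 c'"
  shows "mat_adjoint (X @\<^sub>r Y) * (Z @\<^sub>r W) = mat_adjoint X * Z + mat_adjoint Y * W"
proof -
  have "mat_adjoint (X @\<^sub>r Y)
      = four_block_mat (mat_adjoint X) (mat_adjoint Y) (0\<^sub>m 0 r1) (0\<^sub>m 0 r2)"
    unfolding append_rows_def
    by (subst mat_adjoint_four_block[of _ r1 c _ 0 _ r2])
       (use assms in \<open>auto intro!: cong_four_block_mat eq_matI\<close>)
  then have "mat_adjoint (X @\<^sub>r Y) * (Z @\<^sub>r W)
      = (mat_adjoint X * Z + mat_adjoint Y * W) @\<^sub>r (0\<^sub>m 0 r1 * Z + 0\<^sub>m 0 r2 * W)"
    by (simp add: four_block_mult_append_rows[of _ c r1 _ r2 _ 0 _ _ c'] assms)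
  also have "\<dots> = mat_adjoint X * Z + mat_adjoint Y * W"
    unfolding append_rows_def using assms by (intro eq_matI) auto
  finally show ?thesis .
qed

lemma append_rows_eq_iff:
  assumes "X \<in> carrier_mat r1 c" "Y \<in> carrier_mat r2 c"
    "Z \<in> carrier_mat r1 c" "W \<in> carrier_mat r2 c"
  shows "X @\<^sub>r Y = Z @\<^sub>r W \<longleftrightarrow> X = Z \<and> Y = W"
proof (intro iffI conjI)
  assume eq: "X @\<^sub>r Y = Z @\<^sub>r W"
  show "X = Z"
  proof (rule eq_matI)
    fix i j assume "i < dim_row Z" "j < dim_col Z"
    then show "X $$ (i, j) = Z $$ (i, j)"
      using arg_cong[OF eq, of "\<lambda>N. N $$ (i, j)"] assms by (simp add: append_rows_def)
  qed (use assms in auto)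
  show "Y = W"
  proof (rule eq_matI)
    fix i j assume "i < dim_row W" "j < dim_col W"
    then show "Y $$ (i, j) = W $$ (i, j)"
      using arg_cong[OF eq, of "\<lambda>N. N $$ (r1 + i, j)"] assms by (simp add: append_rows_def)
  qed (use assms in auto)
qed auto

lemma smult_append_rows:
  fixes X Y :: "'a :: semiring_0 mat"
  assumes "X \<in> carrier_mat r1 c" "Y \<in> carrier_mat r2 c"
  shows "a \<cdot>\<^sub>m (X @\<^sub>r Y) = (a \<cdot>\<^sub>m X) @\<^sub>r (a \<cdot>\<^sub>m Y)"
  unfolding append_rows_def using assms by (intro eq_matI) auto

lemma uminus_append_rows:
  fixes X Y :: "'a :: group_add mat"
  assumes "X \<in> carrier_mat r1 c" "Y \<in> carrier_mat r2 c"
  shows "- (X @\<^sub>r Y) = (- X) @\<^sub>r (- Y)"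
  unfolding append_rows_def using assms by (intro eq_matI) auto

lemma append_cols_append_rows:
  assumes "P \<in> carrier_mat r1 c1" "R \<in> carrier_mat r2 c1"
    "Q \<in> carrier_mat r1 c2" "S \<in> carrier_mat r2 c2"
  shows "(P @\<^sub>r R) @\<^sub>c (Q @\<^sub>r S) = four_block_mat P Q R S"
  unfolding append_rows_def append_cols_def using assms by (intro eq_matI) auto

section \<open>The compressed augmented matrix\<close>

text \<open>The basis with blocks \<open>P, P, Q, -Q\<close> passes from the coordinates \<open>t, b\<close> of a stacked
  matrix to their sum and difference; this is the change of variables behind \<open>U\<close> and \<open>W\<close>.\<close>

lemma sum_difference_basis_mult:
  fixes P Q t b :: "complex mat"
  assumes "P \<in> carrier_mat m d" "Q \<in> carrier_mat n d" "t \<in> carrier_mat d q" "b \<in> carrier_mat d q"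
  shows "(a \<cdot>\<^sub>m four_block_mat P P Q (- Q)) * (t @\<^sub>r b)
    = a \<cdot>\<^sub>m ((P * (t + b)) @\<^sub>r (Q * (t - b)))"
proof -
  have "four_block_mat P P Q (- Q) * (t @\<^sub>r b) = (P * t + P * b) @\<^sub>r (Q * t + - Q * b)"
    using assms by (intro four_block_mult_append_rows) auto
  moreover have "P * t + P * b = P * (t + b)"
    using assms by (simp add: mult_add_distrib_mat)
  moreover have "Q * t + - Q * b = Q * (t - b)"
    using assms by (simp add: mult_minus_distrib_mat[of Q n d t q b]
        minus_add_uminus_mat[of "Q * t" n q "Q * b"])
  ultimately show ?thesis
    using assms by (simp add: mult_smult_assoc_mat[of _ "m + n" "d + d" _ q])
qed

text \<open>In sum and difference coordinates the Hermitian dilation of \<open>A\<close> acts blockwise, \<open>A\<close> hitting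
  the difference and its adjoint hitting the sum. The adjoint of the basis then compresses both and
  returns to the original coordinates through another sum and difference.\<close>

lemma compressed_dilation_mult:
  fixes A P Q t b :: "complex mat" and a :: complex
  defines "S \<equiv> a \<cdot>\<^sub>m four_block_mat P P Q (- Q)"
    and "M \<equiv> mat_adjoint P * A * Q"
  assumes A: "A \<in> carrier_mat m n" and P: "P \<in> carrier_mat m d" and Q: "Q \<in> carrier_mat n d"
    and t: "t \<in> carrier_mat d q" and b: "b \<in> carrier_mat d q"
  shows "mat_adjoint S * four_block_mat (0\<^sub>m m m) A (mat_adjoint A) (0\<^sub>m n n) * S * (t @\<^sub>r b)
    = (cnj a * a) \<cdot>\<^sub>m ((M * (t - b) + mat_adjoint M * (t + b))
        @\<^sub>r (M * (t - b) - mat_adjoint M * (t + b)))"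
    (is "_ * ?D * _ * _ = _")
proof -
  let ?u = "P * (t + b)" and ?w = "Q * (t - b)"
  have S: "S \<in> carrier_mat (m + n) (d + d)"
    unfolding S_def using P Q by auto
  have D: "?D \<in> carrier_mat (m + n) (m + n)"
    using A by auto
  note aA = mat_adjoint_carrier[OF A] and aP = mat_adjoint_carrier[OF P]
    and aQ = mat_adjoint_carrier[OF Q]
  have u: "?u \<in> carrier_mat m q" and w: "?w \<in> carrier_mat n q"
    using P Q t b by auto
  have Aw: "A * ?w \<in> carrier_mat m q" and Au: "mat_adjoint A * ?u \<in> carrier_mat n q"
    by (rule mult_carrier_mat[OF A w] mult_carrier_mat[OF mat_adjoint_carrier[OF A] u])+
  have aS: "mat_adjoint S = cnj a \<cdot>\<^sub>m four_block_mat (mat_adjoint P) (mat_adjoint Q)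
      (mat_adjoint P) (- mat_adjoint Q)"
    unfolding S_def mat_adjoint_smult
    by (subst mat_adjoint_four_block[of _ m d _ d _ n]) (use P Q in \<open>auto simp: mat_adjoint_uminus\<close>)
  have Du: "?D * (?u @\<^sub>r ?w) = (A * ?w) @\<^sub>r (mat_adjoint A * ?u)"
    unfolding four_block_mult_append_rows[OF zero_carrier_mat A aA zero_carrier_mat u w]
      left_mult_zero_mat[OF u] left_mult_zero_mat[OF w] left_add_zero_mat[OF Aw]
      right_add_zero_mat[OF Au] ..
  have F: "four_block_mat (mat_adjoint P) (mat_adjoint Q) (mat_adjoint P) (- mat_adjoint Q)
      \<in> carrier_mat (d + d) (m + n)"
    by (rule four_block_carrier_mat[OF aP]) (use aQ in simp)
  have R: "(A * ?w) @\<^sub>r (mat_adjoint A * ?u) \<in> carrier_mat (m + n) q"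
    by (rule carrier_append_rows[OF Aw Au])
  have Mw: "mat_adjoint P * (A * ?w) = M * (t - b)"
    unfolding M_def using assoc_mult_mat[OF aP A w]
      assoc_mult_mat[OF mult_carrier_mat[OF aP A] Q minus_carrier_mat[OF b, of t]] by simp
  have aM: "mat_adjoint M = mat_adjoint Q * (mat_adjoint A * P)"
    unfolding M_def mat_adjoint_mult[OF mult_carrier_mat[OF aP A] Q] mat_adjoint_mult[OF aP A]
    by simp
  have Mu: "mat_adjoint Q * (mat_adjoint A * ?u) = mat_adjoint M * (t + b)"
    unfolding aM using assoc_mult_mat[OF aA P add_carrier_mat[OF b, of t]]
      assoc_mult_mat[OF aQ mult_carrier_mat[OF aA P] add_carrier_mat[OF b, of t]] by simp
  have neg_Mu: "- mat_adjoint Q * (mat_adjoint A * ?u) = - (mat_adjoint M * (t + b))"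
    unfolding Mu[symmetric]
    by (rule uminus_mult_left_mat) (use carrier_matD[OF aQ] carrier_matD[OF Au] in simp)
  have M: "M \<in> carrier_mat d d"
    unfolding M_def using A P Q by auto
  have Mtb: "M * (t - b) \<in> carrier_mat d q" "mat_adjoint M * (t + b) \<in> carrier_mat d q"
    by (rule mult_carrier_mat[OF M minus_carrier_mat[OF b]]
        mult_carrier_mat[OF mat_adjoint_carrier[OF M] add_carrier_mat[OF b]])+
  have tb: "t @\<^sub>r b \<in> carrier_mat (d + d) q"
    using t b by auto
  have "mat_adjoint S * ?D * S * (t @\<^sub>r b) = mat_adjoint S * (?D * (S * (t @\<^sub>r b)))"
    unfolding assoc_mult_mat[OF mult_carrier_mat[OF mat_adjoint_carrier[OF S] D] S tb]
    by (rule assoc_mult_mat[OF mat_adjoint_carrier[OF S] D mult_carrier_mat[OF S tb]])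
  also have "?D * (S * (t @\<^sub>r b)) = a \<cdot>\<^sub>m ((A * ?w) @\<^sub>r (mat_adjoint A * ?u))"
    unfolding S_def sum_difference_basis_mult[OF P Q t b] Du[symmetric]
    by (rule mult_smult_distrib[OF D]) (use u w in auto)
  also have "mat_adjoint S * \<dots> = (cnj a * a) \<cdot>\<^sub>m (four_block_mat (mat_adjoint P) (mat_adjoint Q)
      (mat_adjoint P) (- mat_adjoint Q) * ((A * ?w) @\<^sub>r (mat_adjoint A * ?u)))"
    unfolding aS mult_smult_distrib[OF smult_carrier_mat[OF F] R] mult_smult_assoc_mat[OF F R]
    by (rule eq_matI) simp_all
  also have "four_block_mat (mat_adjoint P) (mat_adjoint Q) (mat_adjoint P) (- mat_adjoint Q)
        * ((A * ?w) @\<^sub>r (mat_adjoint A * ?u))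
      = (M * (t - b) + mat_adjoint M * (t + b)) @\<^sub>r (M * (t - b) - mat_adjoint M * (t + b))"
    unfolding four_block_mult_append_rows[OF aP aQ aP uminus_carrier_mat[OF aQ] Aw Au]
      Mw Mu neg_Mu add_uminus_minus_mat[OF Mtb] ..
  finally show ?thesis .
qed

lemma half_sum_difference_solve:
  fixes X Y :: "complex mat"
  assumes X: "X \<in> carrier_mat r c" and Y: "Y \<in> carrier_mat r c"
    and P: "(1 / 2) \<cdot>\<^sub>m (X + Y) = P" and Q: "(1 / 2) \<cdot>\<^sub>m (X - Y) = Q"
  shows "X = P + Q" "Y = P - Q"
  unfolding P[symmetric] Q[symmetric] using X Y
  by (auto intro!: eq_matI simp: field_simps)

lemma smult_uminus_add:
  fixes X Y :: "complex mat"
  assumes "X \<in> carrier_mat r c" "Y \<in> carrier_mat r c"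
  shows "a \<cdot>\<^sub>m (- X + Y) = - (a \<cdot>\<^sub>m (X - Y))" "a \<cdot>\<^sub>m (- X - Y) = - (a \<cdot>\<^sub>m (X + Y))"
  using assms by (auto intro!: eq_matI simp: algebra_simps)

section \<open>Unitarity of the singular factors\<close>

lemma gram_sum:
  fixes X Y :: "complex mat"
  assumes "X \<in> carrier_mat r c" "Y \<in> carrier_mat r c"
  shows "mat_adjoint (X + Y) * (X + Y) = (mat_adjoint X * X + mat_adjoint Y * Y)
    + (mat_adjoint X * Y + mat_adjoint Y * X)"
proof -
  have "mat_adjoint (X + Y) * (X + Y) = (mat_adjoint X + mat_adjoint Y) * X
      + (mat_adjoint X + mat_adjoint Y) * Y"
    using assms by (simp add: mat_adjoint_add mult_add_distrib_mat[of _ c r])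
  also have "\<dots> = (mat_adjoint X * X + mat_adjoint Y * X) + (mat_adjoint X * Y + mat_adjoint Y * Y)"
    using assms by (simp add: add_mult_distrib_mat[of _ c r])
  also have "\<dots> = (mat_adjoint X * X + mat_adjoint Y * Y) + (mat_adjoint X * Y + mat_adjoint Y * X)"
    using assms by (intro eq_matI) (auto simp: algebra_simps)
  finally show ?thesis .
qed

lemma gram_difference:
  fixes X Y :: "complex mat"
  assumes X: "X \<in> carrier_mat r c" and Y: "Y \<in> carrier_mat r c"
  shows "mat_adjoint (X - Y) * (X - Y) = (mat_adjoint X * X + mat_adjoint Y * Y)
    - (mat_adjoint X * Y + mat_adjoint Y * X)"
proof -
  have "mat_adjoint (X - Y) * (X - Y) = (mat_adjoint X - mat_adjoint Y) * X
      - (mat_adjoint X - mat_adjoint Y) * Y"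
    unfolding mat_adjoint_minus[OF X Y]
    using assms by (intro mult_minus_distrib_mat[of _ c r]) auto
  also have "\<dots> = (mat_adjoint X * X - mat_adjoint Y * X) - (mat_adjoint X * Y - mat_adjoint Y * Y)"
    using assms by (simp add: minus_mult_distrib_mat[of _ c r])
  also have "\<dots> = (mat_adjoint X * X + mat_adjoint Y * Y) - (mat_adjoint X * Y + mat_adjoint Y * X)"
    using assms by (intro eq_matI) (auto simp: algebra_simps)
  finally show ?thesis .
qed

lemma index_mult_diagonal:
  fixes G :: "complex mat"
  assumes "G \<in> carrier_mat d d" "T \<in> carrier_mat d d" "diagonal_mat T" "i < d" "j < d"
  shows "(G * map_mat complex_of_real T) $$ (i, j) = G $$ (i, j) * complex_of_real (T $$ (j, j))"
    and "(map_mat complex_of_real T * G) $$ (i, j) = complex_of_real (T $$ (i, i)) * G $$ (i, j)"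
proof -
  have "(G * map_mat complex_of_real T) $$ (i, j)
      = (\<Sum>l<d. G $$ (i, l) * complex_of_real (T $$ (l, j)))"
    using assms by (simp add: scalar_prod_def lessThan_atLeast0)
  also have "\<dots> = (\<Sum>l<d. if l = j then G $$ (i, j) * complex_of_real (T $$ (j, j)) else 0)"
    using assms by (intro sum.cong) (auto simp: diagonal_mat_def)
  finally show "(G * map_mat complex_of_real T) $$ (i, j)
      = G $$ (i, j) * complex_of_real (T $$ (j, j))"
    using assms by simp
  have "(map_mat complex_of_real T * G) $$ (i, j)
      = (\<Sum>l<d. complex_of_real (T $$ (i, l)) * G $$ (l, j))"
    using assms by (simp add: scalar_prod_def lessThan_atLeast0)
  also have "\<dots> = (\<Sum>l<d. if l = i then complex_of_real (T $$ (i, i)) * G $$ (i, j) else 0)"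
    using assms by (intro sum.cong) (auto simp: diagonal_mat_def)
  finally show "(map_mat complex_of_real T * G) $$ (i, j)
      = complex_of_real (T $$ (i, i)) * G $$ (i, j)"
    using assms by simp
qed

text \<open>Entrywise, the intertwining relation forces \<open>(T\<^sub>i + T\<^sub>j) H\<^sub>i\<^sub>j = 0\<close> off the diagonal, where
  \<open>G = -H\<close>, and \<open>G\<^sub>i\<^sub>i = H\<^sub>i\<^sub>i\<close> on it. Positivity excludes the cancellation \<open>T\<^sub>i = -T\<^sub>j\<close>, which
  would leave \<open>H\<^sub>i\<^sub>j\<close> undetermined. Subtracting the identity from \<open>H\<close> treats both cases at once.\<close>

lemma intertwined_complementary_eq_one:
  fixes G H :: "complex mat"
  assumes G: "G \<in> carrier_mat d d" and H: "H \<in> carrier_mat d d"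
    and T: "T \<in> carrier_mat d d" "diagonal_mat T" and pos: "\<forall>i<d. T $$ (i, i) > 0"
    and comm: "map_mat complex_of_real T * H = G * map_mat complex_of_real T"
    and sum: "G + H = 2 \<cdot>\<^sub>m 1\<^sub>m d"
  shows "G = 1\<^sub>m d" "H = 1\<^sub>m d"
proof -
  have "G $$ (i, j) = 1\<^sub>m d $$ (i, j) \<and> H $$ (i, j) = 1\<^sub>m d $$ (i, j)"
    if ij: "i < d" "j < d" for i j
  proof -
    let ?s = "complex_of_real (T $$ (i, i))" and ?t = "complex_of_real (T $$ (j, j))"
    have c: "?s * H $$ (i, j) = G $$ (i, j) * ?t"
      using arg_cong[OF comm, of "\<lambda>N. N $$ (i, j)"] index_mult_diagonal[OF G T ij]
        index_mult_diagonal[OF H T ij] by simp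
    have s: "G $$ (i, j) + H $$ (i, j) = 2 * 1\<^sub>m d $$ (i, j)"
      using arg_cong[OF sum, of "\<lambda>N. N $$ (i, j)"] ij G H by simp
    have nz: "?s + ?t \<noteq> 0"
      using pos ij by (metis add_pos_pos less_irrefl of_real_0 of_real_add of_real_eq_iff)
    have "(H $$ (i, j) - 1\<^sub>m d $$ (i, j)) * (?s + ?t) = 0"
    proof -
      have e: "1\<^sub>m d $$ (i, j) * ?s = 1\<^sub>m d $$ (i, j) * ?t"
        using ij by (cases "i = j") auto
      \<comment> \<open>Each summand below vanishes by one of the three relations \<open>c\<close>, \<open>s\<close>, \<open>e\<close>.\<close>
      have expand: "(H $$ (i, j) - 1\<^sub>m d $$ (i, j)) * (?s + ?t)
          = (?s * H $$ (i, j) - G $$ (i, j) * ?t)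
            + (G $$ (i, j) + H $$ (i, j) - 2 * 1\<^sub>m d $$ (i, j)) * ?t
            + (1\<^sub>m d $$ (i, j) * ?t - 1\<^sub>m d $$ (i, j) * ?s)"
        by (simp only: ring_distribs) (simp add: mult.commute)
      show ?thesis
        unfolding expand c s e by simp
    qed
    with nz have "H $$ (i, j) = 1\<^sub>m d $$ (i, j)"
      by simp
    with s show ?thesis
      by simp
  qed
  then show "G = 1\<^sub>m d" "H = 1\<^sub>m d"
    using G H by (auto intro!: eq_matI)
qed

lemma unitary_matI:
  assumes "U \<in> carrier_mat d d" "mat_adjoint U * U = 1\<^sub>m d"
  shows "unitary_mat U"
  using assms mat_mult_left_right_inverse[of "mat_adjoint U" d U]
  by (auto simp: unitary_mat_def)

text \<open>The two equations express \<open>U\<^sup>H M W\<close> as \<open>(U\<^sup>H U) T\<close> and as \<open>T (W\<^sup>H W)\<close>, so the Gram matrices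
  of \<open>U\<close> and \<open>W\<close> are intertwined by \<open>T\<close>; as their sum is twice the identity, both are the
  identity.\<close>

lemma singular_pair_unitary:
  fixes M U W :: "complex mat"
  defines "C \<equiv> map_mat complex_of_real"
  assumes M: "M \<in> carrier_mat d d" and U: "U \<in> carrier_mat d d" and W: "W \<in> carrier_mat d d"
    and T: "T \<in> carrier_mat d d" "diagonal_mat T" and pos: "\<forall>i<d. T $$ (i, i) > 0"
    and MW: "M * W = U * C T" and MU: "mat_adjoint M * U = W * C T"
    and sum: "mat_adjoint U * U + mat_adjoint W * W = 2 \<cdot>\<^sub>m 1\<^sub>m d"
  shows "unitary_mat U" "unitary_mat W" "M = U * C T * mat_adjoint W"
proof -
  have CT: "C T \<in> carrier_mat d d"
    unfolding C_def using T by simp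
  note aU = mat_adjoint_carrier[OF U] and aW = mat_adjoint_carrier[OF W]
    and aM = mat_adjoint_carrier[OF M]
  have "C T * (mat_adjoint W * W) = mat_adjoint (W * C T) * W"
    using mat_adjoint_real_diagonal[OF T, folded C_def] CT W aW
    by (simp add: mat_adjoint_mult[OF W CT] assoc_mult_mat[of _ d d _ d])
  also have "\<dots> = mat_adjoint U * (M * W)"
    unfolding MU[symmetric] using M U W aU
    by (simp add: mat_adjoint_mult[OF aM U] assoc_mult_mat[of _ d d _ d])
  also have "\<dots> = mat_adjoint U * U * C T"
    unfolding MW using U aU CT by (simp add: assoc_mult_mat[of _ d d _ d])
  finally have comm: "C T * (mat_adjoint W * W) = mat_adjoint U * U * C T" .
  note one = intertwined_complementary_eq_one[OF _ _ T pos comm[unfolded C_def] sum]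
  show U1: "unitary_mat U" and W1: "unitary_mat W"
    using one U W aU aW by (auto intro!: unitary_matI)
  have "M = M * (W * mat_adjoint W)"
    using W1 W M unfolding unitary_mat_def by simp
  also have "\<dots> = U * C T * mat_adjoint W"
    unfolding MW[symmetric] using assoc_mult_mat[OF M W aW] by simp
  finally show "M = U * C T * mat_adjoint W" .
qed

theorem proposition3p1:
  fixes m n p k :: nat
    and A B S\<^sub>U S\<^sub>W A' S M V_top V_bot V_plus V_minus U\<^sub>p W\<^sub>p X_plus X_minus :: "complex mat"
    and \<Theta> :: "real mat"
  assumes A: "A \<in> carrier_mat m n"
    and B: "B \<in> carrier_mat p n"
    and rank_B: "vec_space.rank p B = n"
    and k: "k \<ge> 1"
    and SU: "S\<^sub>U \<in> carrier_mat m (3 * k)"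
    and SW: "S\<^sub>W \<in> carrier_mat n (3 * k)"
    and SU_orth: "mat_adjoint S\<^sub>U * S\<^sub>U = 1\<^sub>m (3 * k)"
    and SW_orth: "mat_adjoint S\<^sub>W * mat_adjoint B * B * S\<^sub>W = 1\<^sub>m (3 * k)"
    and A'_eq: "A' = four_block_mat (0\<^sub>m m m) A (mat_adjoint A) (0\<^sub>m n n)"
    and S_eq: "S = complex_of_real (1 / sqrt 2) \<cdot>\<^sub>m four_block_mat S\<^sub>U S\<^sub>U S\<^sub>W (- S\<^sub>W)"
    and M_eq: "M = mat_adjoint S\<^sub>U * A * S\<^sub>W"
    and M_nonsing: "invertible_mat M"
    and V_top: "V_top \<in> carrier_mat (3 * k) (3 * k)"
    and V_bot: "V_bot \<in> carrier_mat (3 * k) (3 * k)"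
    and V_plus_eq: "V_plus = V_top @\<^sub>r V_bot"
    and V_plus_orth: "mat_adjoint V_plus * V_plus = 1\<^sub>m (3 * k)"
    and Theta: "\<Theta> \<in> carrier_mat (3 * k) (3 * k)"
    and Theta_diag: "diagonal_mat \<Theta>"
    and Theta_pos: "\<forall>i < 3 * k. \<Theta> $$ (i, i) > 0"
    and V_plus_eig: "mat_adjoint S * A' * S * V_plus = V_plus * map_mat complex_of_real \<Theta>"
    and Up_eq: "U\<^sub>p = V_top + V_bot"
    and Wp_eq: "W\<^sub>p = V_top - V_bot"
    and V_minus_eq: "V_minus = V_bot @\<^sub>r V_top"
    and X_plus_eq: "X_plus = S * V_plus"
    and X_minus_eq: "X_minus = S * V_minus"
  shows "unitary_mat U\<^sub>p \<and> unitary_mat W\<^sub>p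
       \<and> M = U\<^sub>p * map_mat complex_of_real \<Theta> * mat_adjoint W\<^sub>p
       \<and> mat_adjoint S * A' * S * V_minus = - (V_minus * map_mat complex_of_real \<Theta>)
       \<and> mat_adjoint V_minus * V_minus = 1\<^sub>m (3 * k)
       \<and> mat_adjoint V_plus * V_minus = 0\<^sub>m (3 * k) (3 * k)
       \<and> X_plus @\<^sub>c X_minus = (S * V_plus) @\<^sub>c (S * V_minus)
       \<and> (S * V_plus) @\<^sub>c (S * V_minus)
           = complex_of_real (1 / sqrt 2) \<cdot>\<^sub>m
               four_block_mat (S\<^sub>U * U\<^sub>p) (S\<^sub>U * U\<^sub>p) (S\<^sub>W * W\<^sub>p) (- (S\<^sub>W * W\<^sub>p))"
proof -
  let ?d = "3 * k" and ?T = "map_mat complex_of_real \<Theta>"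
  let ?a = "complex_of_real (1 / sqrt 2)" and ?M' = "mat_adjoint M"
  let ?G = "mat_adjoint V_top * V_top + mat_adjoint V_bot * V_bot"
  let ?K = "mat_adjoint V_top * V_bot + mat_adjoint V_bot * V_top"
  have M: "M \<in> carrier_mat ?d ?d"
    unfolding M_eq using A SU SW by auto
  have U: "U\<^sub>p \<in> carrier_mat ?d ?d" and W: "W\<^sub>p \<in> carrier_mat ?d ?d" and T: "?T \<in> carrier_mat ?d ?d"
    unfolding Up_eq Wp_eq using V_top V_bot Theta by auto
  have XY: "M * W\<^sub>p \<in> carrier_mat ?d ?d" "?M' * U\<^sub>p \<in> carrier_mat ?d ?d"
    by (rule mult_carrier_mat[OF M W] mult_carrier_mat[OF mat_adjoint_carrier[OF M] U])+
  have VT: "V_top * ?T \<in> carrier_mat ?d ?d" "V_bot * ?T \<in> carrier_mat ?d ?d"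
    by (rule mult_carrier_mat[OF V_top T] mult_carrier_mat[OF V_bot T])+
  have half: "cnj ?a * ?a = 1 / 2"
  proof -
    have "cnj ?a * ?a = complex_of_real (1 / sqrt 2 * (1 / sqrt 2))"
      unfolding of_real_mult complex_cnj_complex_of_real ..
    then show ?thesis
      by simp
  qed
  have compressed: "mat_adjoint S * A' * S * (t @\<^sub>r b)
      = ((1 / 2) \<cdot>\<^sub>m (M * (t - b) + ?M' * (t + b))) @\<^sub>r ((1 / 2) \<cdot>\<^sub>m (M * (t - b) - ?M' * (t + b)))"
    if "t \<in> carrier_mat ?d ?d" "b \<in> carrier_mat ?d ?d" for t b
    unfolding S_eq A'_eq compressed_dilation_mult[OF A SU SW that] half M_eq[symmetric]
    by (rule smult_append_rows[of _ ?d ?d _ ?d]) (use that M in auto)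
  have "((1 / 2) \<cdot>\<^sub>m (M * W\<^sub>p + ?M' * U\<^sub>p)) @\<^sub>r ((1 / 2) \<cdot>\<^sub>m (M * W\<^sub>p - ?M' * U\<^sub>p))
      = (V_top * ?T) @\<^sub>r (V_bot * ?T)"
    using V_plus_eig compressed[OF V_top V_bot] append_rows_mult[OF V_top V_bot T]
    unfolding V_plus_eq Up_eq Wp_eq by simp
  then have "(1 / 2) \<cdot>\<^sub>m (M * W\<^sub>p + ?M' * U\<^sub>p) = V_top * ?T
      \<and> (1 / 2) \<cdot>\<^sub>m (M * W\<^sub>p - ?M' * U\<^sub>p) = V_bot * ?T"
    by (rule iffD1[OF append_rows_eq_iff, rotated -1])
       (rule smult_carrier_mat add_carrier_mat minus_carrier_mat XY VT)+
  then have top: "(1 / 2) \<cdot>\<^sub>m (M * W\<^sub>p + ?M' * U\<^sub>p) = V_top * ?T"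
    and bot: "(1 / 2) \<cdot>\<^sub>m (M * W\<^sub>p - ?M' * U\<^sub>p) = V_bot * ?T"
    by simp_all
  note MW_MU = half_sum_difference_solve[OF XY top bot]
  have MW: "M * W\<^sub>p = U\<^sub>p * ?T"
    unfolding MW_MU(1) Up_eq by (rule add_mult_distrib_mat[OF V_top V_bot T, symmetric])
  have MU: "?M' * U\<^sub>p = W\<^sub>p * ?T"
    unfolding MW_MU(2) Wp_eq by (rule minus_mult_distrib_mat[OF V_top V_bot T, symmetric])
  have G: "?G = 1\<^sub>m ?d"
    using V_plus_orth adjoint_append_rows_mult[OF V_top V_bot V_top V_bot] V_plus_eq by simp
  have K: "?K \<in> carrier_mat ?d ?d"
    using V_top V_bot by auto
  have gramU: "mat_adjoint U\<^sub>p * U\<^sub>p = 1\<^sub>m ?d + ?K"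
    unfolding Up_eq gram_sum[OF V_top V_bot] G ..
  have gramW: "mat_adjoint W\<^sub>p * W\<^sub>p = 1\<^sub>m ?d - ?K"
    unfolding Wp_eq gram_difference[OF V_top V_bot] G ..
  have sum: "mat_adjoint U\<^sub>p * U\<^sub>p + mat_adjoint W\<^sub>p * W\<^sub>p = 2 \<cdot>\<^sub>m 1\<^sub>m ?d"
    unfolding gramU gramW using K V_top V_bot by (intro eq_matI) auto
  note unitary = singular_pair_unitary[OF M U W Theta Theta_diag Theta_pos MW MU sum]
  \<comment> \<open>\<open>?K\<close> is the cross term by which the Gram matrix of \<open>U\<^sub>p\<close> deviates from that of \<open>V_plus\<close>.\<close>
  have K0: "?K = 0\<^sub>m ?d ?d"
  proof -
    have "?K = (1\<^sub>m ?d + ?K) - 1\<^sub>m ?d"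
      using V_top V_bot by (intro eq_matI) auto
    also have "1\<^sub>m ?d + ?K = 1\<^sub>m ?d"
      using unitary(1) carrier_matD(1)[OF U] unfolding unitary_mat_def gramU by simp
    finally show ?thesis
      by (simp add: minus_r_inv_mat[of _ ?d ?d])
  qed
  have eig_minus: "mat_adjoint S * A' * S * V_minus = - (V_minus * ?T)"
  proof -
    \<comment> \<open>Swapping the two blocks keeps their sum and negates their difference.\<close>
    have "M * (V_bot - V_top) = - (M * W\<^sub>p)"
    proof -
      have "V_bot - V_top = - W\<^sub>p"
        unfolding Wp_eq using V_top V_bot by (intro eq_matI) auto
      then show ?thesis
        using M W by simp
    qed
    moreover have "V_bot + V_top = U\<^sub>p"
      unfolding Up_eq using V_top V_bot by (rule comm_add_mat[symmetric])
    ultimately have "mat_adjoint S * A' * S * V_minus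
        = ((1 / 2) \<cdot>\<^sub>m (- (M * W\<^sub>p) + ?M' * U\<^sub>p)) @\<^sub>r ((1 / 2) \<cdot>\<^sub>m (- (M * W\<^sub>p) - ?M' * U\<^sub>p))"
      unfolding V_minus_eq compressed[OF V_bot V_top] by simp
    also have "(1 / 2) \<cdot>\<^sub>m (- (M * W\<^sub>p) + ?M' * U\<^sub>p) = - (V_bot * ?T)"
      unfolding smult_uminus_add(1)[OF XY] bot ..
    also have "(1 / 2) \<cdot>\<^sub>m (- (M * W\<^sub>p) - ?M' * U\<^sub>p) = - (V_top * ?T)"
      unfolding smult_uminus_add(2)[OF XY] top ..
    also have "(- (V_bot * ?T)) @\<^sub>r (- (V_top * ?T)) = - (V_minus * ?T)"
      unfolding V_minus_eq append_rows_mult[OF V_bot V_top T]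
      by (rule uminus_append_rows[symmetric]) (rule VT)+
    finally show ?thesis .
  qed
  have orth_minus: "mat_adjoint V_minus * V_minus = 1\<^sub>m ?d"
    unfolding V_minus_eq adjoint_append_rows_mult[OF V_bot V_top V_bot V_top] G[symmetric]
    using V_top V_bot by (intro comm_add_mat[of _ ?d ?d]) auto
  have orth_plus_minus: "mat_adjoint V_plus * V_minus = 0\<^sub>m ?d ?d"
    unfolding V_minus_eq V_plus_eq adjoint_append_rows_mult[OF V_top V_bot V_bot V_top] K0 ..
  have "(S * V_plus) @\<^sub>c (S * V_minus)
      = ?a \<cdot>\<^sub>m four_block_mat (S\<^sub>U * U\<^sub>p) (S\<^sub>U * U\<^sub>p) (S\<^sub>W * W\<^sub>p) (- (S\<^sub>W * W\<^sub>p))"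
  proof -
    have plus: "S * V_plus = (?a \<cdot>\<^sub>m (S\<^sub>U * U\<^sub>p)) @\<^sub>r (?a \<cdot>\<^sub>m (S\<^sub>W * W\<^sub>p))"
      unfolding S_eq V_plus_eq sum_difference_basis_mult[OF SU SW V_top V_bot] Up_eq Wp_eq
      by (rule smult_append_rows) (use SU SW V_top V_bot in auto)
    have u: "V_bot + V_top = U\<^sub>p" and w: "V_bot - V_top = - W\<^sub>p"
      unfolding Up_eq Wp_eq using V_top V_bot by (auto intro!: eq_matI)
    have "S * V_minus = ?a \<cdot>\<^sub>m ((S\<^sub>U * U\<^sub>p) @\<^sub>r (- (S\<^sub>W * W\<^sub>p)))"
      unfolding S_eq V_minus_eq sum_difference_basis_mult[OF SU SW V_bot V_top] u w
      using SW W by simp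
    then have minus: "S * V_minus = (?a \<cdot>\<^sub>m (S\<^sub>U * U\<^sub>p)) @\<^sub>r (?a \<cdot>\<^sub>m (- (S\<^sub>W * W\<^sub>p)))"
      using smult_append_rows[of "S\<^sub>U * U\<^sub>p" m ?d "- (S\<^sub>W * W\<^sub>p)" n ?a] SU SW U W by auto
    show ?thesis
      unfolding plus minus
      by (subst append_cols_append_rows[of _ m ?d _ n _ ?d]) (use SU SW U W in auto)
  qed
  with unitary eig_minus orth_minus orth_plus_minus show ?thesis
    unfolding X_plus_eq X_minus_eq by blast
qed

end
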